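(* Let $M$ be a pointed metric space such that $\mathrm{LipSNA}(M,\mathbb{R})$ is dense in $\mathrm{Lip}_0(M,\mathbb{R})$ and let $Y$ be a Banach space having $ACK$ structure with some parameter $\rho\in[0,1)$. Then $\mathrm{LipSNA}_K(M,Y)$ is dense in $\mathrm{Lip}_{0K}(M,Y)$.
   Context: All metric spaces are complete and all Banach spaces are real. $B_X$, $S_X$ are the closed unit ball and unit sphere of a Banach space $X$; $L(X,Y)$ is the space of bounded linear operators; $w^*$ is the weak-star topology. A pointed metric space is a metric space $(M,d)$ with a distinguished point $0\in M$. $\mathrm{Lip}_0(M,Y)$ is the Banach space of Lipschitz maps $F\colon M\to Y$ with $F(0)=0$, with norm $\|F\|_L=\sup\{\|F(p)-F(q)\|/d(p,q)\colon p\neq q\}$. $F$ strongly attains its norm if there are $p\neq q$ in $M$ with $\|F(p)-F(q)\|/d(p,q)=\|F\|_L$; $\mathrm{LipSNA}(M,Y)$ is the set of such maps. $F\in\mathrm{Lip}_0(M,Y)$ is Lipschitz compact if $\{(F(p)-F(q))/d(p,q)\colon p\neq q\}$ is relatively compact in $Y$; $\mathrm{Lip}_{0K}(M,Y)$ is the space of such maps, and $\mathrm{LipSNA}_K(M,Y)=\mathrm{LipSNA}(M,Y)\cap\mathrm{Lip}_{0K}(M,Y)$. Density is with respect to $\|\cdot\|_L$. A set $\Gamma\subseteq B_{Y^*}$ is $1$-norming if $\|y\|=\sup\{|f(y)|\colon f\in\Gamma\}$ for all $y\in Y$. A Banach space $Y$ has $ACK$ structure with parameter $\rho\in[0,1)$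 (written $Y\in ACK_\rho$) if there is a $1$-norming set $\Gamma\subseteq B_{Y^*}$ such that for every $\varepsilon>0$ and every nonempty relatively $w^*$-open $U\subseteq\Gamma$ there exist a nonempty $V\subseteq U$, $y_1^*\in V$, $e\in S_Y$ and $F\in L(Y,Y)$ such that: (1) $\|Fe\|=\|F\|=1$; (2) $y_1^*(Fe)=1$; (3) $F^*y_1^*=y_1^*$; (4) with $V_1=\{y^*\in\Gamma\colon\|F^*y^*\|+(1-\varepsilon)\|(\mathrm{Id}_{Y^*}-F^* )(y^* )\|\leq1\}$, one has $|v^*(Fe)|\leq\rho$ for all $v^*\in\Gamma\setminus V_1$; (5) $d(F^*y^*,\mathrm{aco}\{0,V\})<\varepsilon$ for every $y^*\in\Gamma$, where $\mathrm{aco}\{0,V\}$ is the absolutely convex hull of $\{0\}\cup V$; (6) $|v^*(e)-1|\leq\varepsilon$ for every $v^*\in V$. *)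

theory Defs
  imports "HOL-Analysis.Analysis"
begin

section \<open>Lipschitz maps on a pointed metric space\<close>

text \<open>
  A pointed metric space is a type of class \<^class>\<open>complete_space\<close> together with an
  arbitrary element \<open>z\<close> as distinguished point.
\<close>

definition Lip0 :: "'m::metric_space \<Rightarrow> ('m \<Rightarrow> 'y::real_normed_vector) set" where
  "Lip0 z = {F. (\<exists>C. C-lipschitz_on UNIV F) \<and> F z = 0}"

text \<open>
  On the reals \<^term>\<open>Sup {}\<close> is unspecified. Inserting \<open>0\<close> into a set of nonnegative numbers
  does not change a supremum and implements the convention that the empty supremum is \<open>0\<close>
  (here only relevant if the metric space has a single point).
\<close>

definition lip_norm :: "('m::metric_space \<Rightarrow> 'y::real_normed_vector) \<Rightarrow> real" where
  "lip_norm F = Sup (insert 0 {norm (F p - F q) / dist p q | p q. p \<noteq> q})"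

definition LipSNA :: "'m::metric_space \<Rightarrow> ('m \<Rightarrow> 'y::real_normed_vector) set" where
  "LipSNA z = {F \<in> Lip0 z. \<exists>p q. p \<noteq> q \<and> norm (F p - F q) / dist p q = lip_norm F}"

definition Lip0K :: "'m::metric_space \<Rightarrow> ('m \<Rightarrow> 'y::real_normed_vector) set" where
  "Lip0K z = {F \<in> Lip0 z. compact (closure {(F p - F q) /\<^sub>R dist p q | p q. p \<noteq> q})}"

definition LipSNA_K :: "'m::metric_space \<Rightarrow> ('m \<Rightarrow> 'y::real_normed_vector) set" where
  "LipSNA_K z = LipSNA z \<inter> Lip0K z"

definition lip_dense_in ::
  "('m::metric_space \<Rightarrow> 'y::real_normed_vector) set \<Rightarrow> ('m \<Rightarrow> 'y) set \<Rightarrow> bool" where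
  "lip_dense_in S T \<longleftrightarrow>
     S \<subseteq> T \<and> (\<forall>F\<in>T. \<forall>\<epsilon>>0. \<exists>G\<in>S. lip_norm (\<lambda>p. F p - G p) < \<epsilon>)"


section \<open>ACK structure\<close>

text \<open>
  The dual of \<open>'y\<close> is \<open>'y \<Rightarrow>\<^sub>L real\<close>. For scalar-valued operators the strong operator
  topology is the topology of pointwise convergence, i.e. the weak-star topology.
\<close>

abbreviation weak_star :: "('y::real_normed_vector \<Rightarrow>\<^sub>L real) topology" where
  "weak_star \<equiv> strong_operator_topology"

definition adjoint_blinfun ::
  "('x::real_normed_vector \<Rightarrow>\<^sub>L 'y::real_normed_vector) \<Rightarrow> ('y \<Rightarrow>\<^sub>L real) \<Rightarrow> ('x \<Rightarrow>\<^sub>L real)" where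
  "adjoint_blinfun F f = f o\<^sub>L F"

definition absolutely_convex :: "'a::real_vector set \<Rightarrow> bool" where
  "absolutely_convex S \<longleftrightarrow> convex S \<and> (\<forall>x\<in>S. \<forall>c. \<bar>c\<bar> \<le> 1 \<longrightarrow> c *\<^sub>R x \<in> S)"

text \<open>As for \<^const>\<open>lip_norm\<close>, the inserted \<open>0\<close> only fixes the value of the empty supremum.\<close>

definition one_norming :: "('y::real_normed_vector \<Rightarrow>\<^sub>L real) set \<Rightarrow> bool" where
  "one_norming \<Gamma> \<longleftrightarrow> \<Gamma> \<subseteq> cball 0 1 \<and>
     (\<forall>y. norm y = Sup (insert 0 {\<bar>blinfun_apply f y\<bar> | f. f \<in> \<Gamma>}))"

definition ACK_V1 ::
  "('y::real_normed_vector \<Rightarrow>\<^sub>L real) set \<Rightarrow> real \<Rightarrow> ('y \<Rightarrow>\<^sub>L 'y) \<Rightarrow> ('y \<Rightarrow>\<^sub>L real) set" where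
  "ACK_V1 \<Gamma> \<epsilon> F =
     {f \<in> \<Gamma>. norm (adjoint_blinfun F f) + (1 - \<epsilon>) * norm (f - adjoint_blinfun F f) \<le> 1}"

definition has_ACK_structure :: "'y::banach itself \<Rightarrow> real \<Rightarrow> bool" where
  "has_ACK_structure (_ :: 'y itself) \<rho> \<longleftrightarrow>
    (\<exists>\<Gamma> :: ('y \<Rightarrow>\<^sub>L real) set. one_norming \<Gamma> \<and>
      (\<forall>\<epsilon>>0. \<forall>U. openin (subtopology weak_star \<Gamma>) U \<and> U \<noteq> {} \<longrightarrow>
        (\<exists>V y1 e. \<exists>F :: 'y \<Rightarrow>\<^sub>L 'y.
           V \<noteq> {} \<and> V \<subseteq> U \<and> y1 \<in> V \<and> e \<in> sphere 0 1 \<and>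
           norm (blinfun_apply F e) = 1 \<and> norm F = 1 \<and>
           blinfun_apply y1 (blinfun_apply F e) = 1 \<and>
           adjoint_blinfun F y1 = y1 \<and>
           (\<forall>v \<in> \<Gamma> - ACK_V1 \<Gamma> \<epsilon> F. \<bar>blinfun_apply v (blinfun_apply F e)\<bar> \<le> \<rho>) \<and>
           (\<forall>f \<in> \<Gamma>. infdist (adjoint_blinfun F f) (absolutely_convex hull ({0} \<union> V)) < \<epsilon>) \<and>
           (\<forall>v \<in> V. \<bar>blinfun_apply v e - 1\<bar> \<le> \<epsilon>))))"

end

theory Submission
  imports Defs
begin

text \<open>
  Let \<open>G\<close> be Lipschitz compact of norm \<open>L > 0\<close>. By compactness, \<open>f \<mapsto> f \<circ> G\<close> is weak-star to norm
  continuous on \<open>\<Gamma>\<close>, so that it is almost constant on a relatively open set \<open>U\<close> of functionals that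
  almost norm \<open>G\<close>. The ACK structure applied to \<open>U\<close> gives \<open>y1\<close>, \<open>e\<close> and \<open>F\<close>; the scalar hypothesis
  gives a strongly attaining \<open>h\<close> of norm \<open>L\<close> close to \<open>y1 \<circ> G\<close>. The approximant is
  \<open>p \<mapsto> h p \<cdot> F e + (1 - \<eta>) (G p - F (G p))\<close>. It is close to \<open>G\<close> because \<open>f \<circ> F \<circ> G\<close> is close to
  \<open>f (F e) \<cdot> (y1 \<circ> G)\<close> for all \<open>f \<in> \<Gamma>\<close>; its norm is at most \<open>L\<close>, as can be tested on \<open>\<Gamma>\<close> by
  distinguishing whether \<open>f\<close> lies in \<open>V1\<close>; and composing it with \<open>y1\<close> returns \<open>h\<close>, so it attains
  its norm where \<open>h\<close> does.
\<close>

section \<open>The Lipschitz norm as a supremum of slopes\<close>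

lemma lip_norm_le:
  assumes "0 \<le> C" and "\<And>p q. norm (F p - F q) \<le> C * dist p q"
  shows "lip_norm F \<le> C"
  unfolding lip_norm_def
  using assms by (intro cSup_least) (auto simp: divide_le_eq)

text \<open>\<open>Sup\<close> on the reals is informative only for sets bounded above, so a
  Lipschitz constant must be known before \<open>lip_norm\<close> can bound any single
  slope.\<close>

lemma bdd_above_lip_quotients:
  assumes "C-lipschitz_on UNIV F"
  shows "bdd_above (insert 0 {norm (F p - F q) / dist p q | p q. p \<noteq> q})"
proof -
  have "norm (F p - F q) / dist p q \<le> C" if "p \<noteq> q" for p q
    using lipschitz_onD[OF assms, of p q] that by (simp add: dist_norm divide_le_eq)
  then show ?thesis
    using lipschitz_on_nonneg[OF assms] by (intro bdd_aboveI[of _ C]) auto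
qed

lemma lip_norm_nonneg:
  assumes "F \<in> Lip0 z"
  shows "0 \<le> lip_norm F"
  using assms unfolding lip_norm_def Lip0_def
  by (auto intro: cSup_upper bdd_above_lip_quotients)

lemma norm_diff_le_lip_norm:
  assumes "F \<in> Lip0 z"
  shows "norm (F p - F q) \<le> lip_norm F * dist p q"
proof (cases "p = q")
  case False
  obtain C where "C-lipschitz_on UNIV F"
    using assms by (auto simp: Lip0_def)
  then have "norm (F p - F q) / dist p q \<le> lip_norm F"
    unfolding lip_norm_def using False by (intro cSup_upper bdd_above_lip_quotients) auto
  with False show ?thesis by (simp add: divide_le_eq)
qed simp

lemma Lip0I:
  assumes "0 \<le> C" and "\<And>p q. norm (F p - F q) \<le> C * dist p q" and "F z = 0"
  shows "F \<in> Lip0 z"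
  using assms by (auto simp: Lip0_def dist_norm intro!: exI[of _ C] lipschitz_onI)

lemma less_lip_normD:
  assumes "c < lip_norm F" and "0 \<le> c"
  obtains p q where "p \<noteq> q" and "c * dist p q < norm (F p - F q)"
proof -
  obtain p q where "c * dist p q < norm (F p - F q)"
    using lip_norm_le[of c F] assms by (meson not_le)
  then show thesis using that[of p q] by (cases "p = q") auto
qed

section \<open>Estimates with functionals in a norming set\<close>

lemma norm_le_of_one_norming:
  assumes "one_norming \<Gamma>" and "0 \<le> c" and "\<And>f. f \<in> \<Gamma> \<Longrightarrow> \<bar>blinfun_apply f y\<bar> \<le> c"
  shows "norm y \<le> c"
proof -
  have "Sup (insert 0 {\<bar>blinfun_apply f y\<bar> | f. f \<in> \<Gamma>}) \<le> c"
    using assms(2,3) by (intro cSup_least) auto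
  with assms(1) show ?thesis by (simp add: one_norming_def)
qed

lemma abs_blinfun_le_norm:
  fixes f :: "'y::real_normed_vector \<Rightarrow>\<^sub>L real"
  assumes "norm f \<le> 1"
  shows "\<bar>f x\<bar> \<le> norm x"
  using norm_blinfun[of f x] mult_right_mono[OF assms norm_ge_zero[of x]] by simp

text \<open>Functionals in the dual ball are 1-Lipschitz, so agreement with \<open>f0\<close> within
  \<open>\<delta>/3\<close> on a finite \<open>\<delta>/3\<close>-net of \<open>K\<close> forces
  agreement within \<delta> on all of \<open>K\<close>. Finitely many evaluations cut out a
  weak-star open set.\<close>

lemma weak_star_nbhd_uniform_on_compact:
  fixes f0 :: "'y::real_normed_vector \<Rightarrow>\<^sub>L real"
  assumes "compact K" and "\<Gamma> \<subseteq> cball 0 1" and "f0 \<in> \<Gamma>" and "0 < \<delta>"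
  obtains U where "openin (subtopology weak_star \<Gamma>) U" and "f0 \<in> U"
    and "\<And>f k. f \<in> U \<Longrightarrow> k \<in> K \<Longrightarrow> \<bar>f k - f0 k\<bar> \<le> \<delta>"
proof -
  obtain N where N: "finite N" "K \<subseteq> (\<Union>x\<in>N. ball x (\<delta>/3))"
    using assms(1,4) compact_eq_totally_bounded[of K] by (metis divide_pos_pos zero_less_numeral)
  define W where "W = (\<Inter>x\<in>N. {f \<in> topspace weak_star. f x \<in> ball (f0 x) (\<delta>/3)}) \<inter> topspace weak_star"
  have "openin weak_star {f \<in> topspace weak_star. blinfun_apply f x \<in> ball (f0 x) (\<delta>/3)}" for x
    by (rule openin_continuous_map_preimage[OF strong_operator_topology_continuous_evaluation]) simp
  then have "openin weak_star W"
    unfolding W_def using N(1) by (cases "N = {}") (auto intro!: openin_INT)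
  show thesis
  proof (rule that[of "\<Gamma> \<inter> W"])
    show "openin (subtopology weak_star \<Gamma>) (\<Gamma> \<inter> W)"
      using \<open>openin weak_star W\<close> by (rule openin_subtopology_Int2)
    show "f0 \<in> \<Gamma> \<inter> W"
      using assms(3,4) by (simp add: W_def strong_operator_topology_topspace)
    fix f k assume f: "f \<in> \<Gamma> \<inter> W" and "k \<in> K"
    then obtain x where x: "x \<in> N" "dist x k < \<delta>/3"
      using N(2) by auto
    have "norm f \<le> 1" "norm f0 \<le> 1"
      using f assms(2,3) by auto
    then have "\<bar>f (k - x)\<bar> \<le> norm (k - x)" "\<bar>f0 (k - x)\<bar> \<le> norm (k - x)"
      by (auto intro: abs_blinfun_le_norm)
    moreover have "\<bar>f0 x - f x\<bar> < \<delta>/3"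
      using f x(1) by (auto simp: W_def dist_real_def)
    moreover have "norm (k - x) < \<delta>/3"
      using x(2) by (simp add: dist_norm norm_minus_commute)
    ultimately show "\<bar>f k - f0 k\<bar> \<le> \<delta>"
      unfolding blinfun.diff_right by linarith
  qed
qed

text \<open>The condition on \<open>f\<close> below is linear in \<open>f\<close>, so it passes from \<open>V\<close> to its absolutely convex hull.\<close>

lemma absolutely_convex_hull_estimate:
  fixes V :: "('y::real_normed_vector \<Rightarrow>\<^sub>L real) set"
  assumes "a \<in> absolutely_convex hull ({0} \<union> V)" and "0 \<le> c"
    and "\<And>f. f \<in> V \<Longrightarrow> \<bar>f x - f e * t\<bar> \<le> c"
  shows "\<bar>a x - a e * t\<bar> \<le> c"
proof -
  let ?S = "{f :: 'y \<Rightarrow>\<^sub>L real. \<bar>f x - f e * t\<bar> \<le> c}"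
  have eq: "?S = (\<lambda>f. blinfun_apply f (x - t *\<^sub>R e)) -` {-c..c}"
    by (auto simp: blinfun.diff_right blinfun.scaleR_right algebra_simps abs_le_iff)
  have "linear (\<lambda>f :: 'y \<Rightarrow>\<^sub>L real. f (x - t *\<^sub>R e))"
    by (intro linearI) (simp_all add: blinfun.add_left blinfun.scaleR_left)
  then have "convex ?S"
    unfolding eq by (intro convex_linear_vimage) auto
  moreover have "r *\<^sub>R f \<in> ?S" if "f \<in> ?S" "\<bar>r\<bar> \<le> 1" for f r
  proof -
    have "\<bar>r * (f x - f e * t)\<bar> \<le> 1 * c"
      unfolding abs_mult using that by (intro mult_mono) auto
    then show ?thesis by (simp add: blinfun.scaleR_left algebra_simps)
  qed
  ultimately have "absolutely_convex ?S"
    by (auto simp: absolutely_convex_def)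
  then have "absolutely_convex hull ({0} \<union> V) \<subseteq> ?S"
    using assms(2,3) by (intro hull_minimal) auto
  with assms(1) show ?thesis by auto
qed

text \<open>Some \<open>a\<close> in the hull is \<epsilon>-close to the adjoint image of
  \<open>f\<close>, and it satisfies the claim with error \<open>c + \<epsilon> * l\<close> because
  the members of \<open>V\<close> do. Exchanging \<open>a\<close> for \<open>f\<close> after
  \<open>F\<close>, once at \<open>x\<close> and once at \<open>e\<close>, costs
  \<open>\<epsilon> * l\<close> each time.\<close>

lemma adjoint_estimate:
  fixes V :: "('y::real_normed_vector \<Rightarrow>\<^sub>L real) set" and f y1 :: "'y \<Rightarrow>\<^sub>L real"
  assumes "infdist (adjoint_blinfun F f) (absolutely_convex hull ({0} \<union> V)) < \<epsilon>"
    and "norm e = 1" and "norm y1 \<le> 1" and "norm x \<le> l"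
    and "\<And>g. g \<in> V \<Longrightarrow> \<bar>g x - y1 x\<bar> \<le> c" and "\<And>g. g \<in> V \<Longrightarrow> \<bar>g e - 1\<bar> \<le> \<epsilon>" and "0 \<le> c"
  shows "\<bar>f (F x) - f (F e) * y1 x\<bar> \<le> c + 3 * \<epsilon> * l"
proof -
  \<comment> \<open>\<open>infdist\<close> to the empty set is 0 by convention; only for a nonempty
    hull does the hypothesis yield a nearby point \<open>a\<close>.\<close>
  have "0 \<in> absolutely_convex hull ({0} \<union> V)"
    by (simp add: hull_inc)
  then obtain a where a: "a \<in> absolutely_convex hull ({0} \<union> V)" "dist (adjoint_blinfun F f) a < \<epsilon>"
    using assms(1) by (auto simp: infdist_def cINF_less_iff split: if_splits)
  have \<epsilon>: "0 \<le> \<epsilon>"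
    using a(2) zero_le_dist[of "adjoint_blinfun F f" a] by linarith
  have y1: "\<bar>y1 x\<bar> \<le> l"
    using abs_blinfun_le_norm[OF assms(3), of x] assms(4) by linarith
  have l: "0 \<le> l" using y1 by linarith
  have "\<bar>a x - a e * y1 x\<bar> \<le> c + \<epsilon> * l"
  proof (rule absolutely_convex_hull_estimate[OF a(1)])
    show "0 \<le> c + \<epsilon> * l" using assms(7) \<epsilon> l by simp
    fix g assume g: "g \<in> V"
    have "\<bar>(g e - 1) * y1 x\<bar> \<le> \<epsilon> * l"
      unfolding abs_mult using assms(6)[OF g] y1 \<epsilon> by (intro mult_mono) auto
    moreover have "g x - g e * y1 x = (g x - y1 x) - (g e - 1) * y1 x"
      by (simp add: algebra_simps)
    ultimately show "\<bar>g x - g e * y1 x\<bar> \<le> c + \<epsilon> * l"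
      using assms(5)[OF g] by linarith
  qed
  moreover have dist: "\<bar>f (F u) - a u\<bar> \<le> \<epsilon> * norm u" for u
  proof -
    have "\<bar>(adjoint_blinfun F f - a) u\<bar> \<le> norm (adjoint_blinfun F f - a) * norm u"
      using norm_blinfun[of "adjoint_blinfun F f - a" u] by simp
    also have "\<dots> \<le> \<epsilon> * norm u"
      using a(2) by (intro mult_right_mono) (auto simp: dist_norm)
    finally show ?thesis by (simp add: blinfun.diff_left adjoint_blinfun_def)
  qed
  moreover have "\<epsilon> * norm x \<le> \<epsilon> * l"
    using assms(4) \<epsilon> by (rule mult_left_mono)
  moreover have "\<bar>(f (F e) - a e) * y1 x\<bar> \<le> \<epsilon> * l"
    unfolding abs_mult using dist[of e] assms(2) y1 \<epsilon> by (intro mult_mono) auto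
  moreover have "f (F x) - f (F e) * y1 x = 
      (f (F x) - a x) + (a x - a e * y1 x) - (f (F e) - a e) * y1 x"
    by (simp add: algebra_simps)
  ultimately show ?thesis
    using dist[of x] by linarith
qed

section \<open>Scalar approximation with prescribed norm\<close>

text \<open>Density gives an attaining map within \<kappa> of \<open>h\<close>; scaling it to norm
  \<open>L\<close> keeps the pair of points where it attains. Slopes move by \<kappa> in the first
  step and by at most \<open>\<delta> + \<kappa>\<close> in the second. The bound
  \<open>\<delta> + \<kappa> < L\<close> makes the norm to be scaled positive.\<close>

lemma LipSNA_approx_with_norm:
  fixes h :: "'m::metric_space \<Rightarrow> real"
  assumes dense: "lip_dense_in (LipSNA z) (Lip0 z :: ('m \<Rightarrow> real) set)"
    and h: "h \<in> Lip0 z" and "lip_norm h \<le> L" and "L - \<delta> \<le> lip_norm h" and "0 < \<kappa>" and "\<delta> + \<kappa> < L"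
  obtains g where "g \<in> LipSNA z" and "lip_norm g = L"
    and "\<And>p q. \<bar>(g p - g q) - (h p - h q)\<bar> \<le> (\<delta> + 2 * \<kappa>) * dist p q"
proof -
  obtain g where g: "g \<in> LipSNA z" and lt: "lip_norm (\<lambda>p. h p - g p) < \<kappa>"
    using dense h \<open>0 < \<kappa>\<close> unfolding lip_dense_in_def by blast
  have g0: "g \<in> Lip0 z" using g by (simp add: LipSNA_def)
  note hle = norm_diff_le_lip_norm[OF h] and gle = norm_diff_le_lip_norm[OF g0]
  \<comment> \<open>Membership bounds the slopes of the difference, so that \<open>lt\<close>
    controls each of them.\<close>
  have "(\<lambda>p. h p - g p) \<in> Lip0 z"
  proof (rule Lip0I)
    show "0 \<le> lip_norm h + lip_norm g"
      using lip_norm_nonneg[OF h] lip_norm_nonneg[OF g0] by simp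
    show "norm (h p - g p - (h q - g q)) \<le> (lip_norm h + lip_norm g) * dist p q" for p q
      using hle[of p q] gle[of p q] by (simp add: algebra_simps)
    show "h z - g z = 0" using h g0 by (simp add: Lip0_def)
  qed
  note dle = norm_diff_le_lip_norm[OF this]
  have close: "\<bar>(g p - g q) - (h p - h q)\<bar> \<le> \<kappa> * dist p q" for p q
  proof -
    have "\<bar>(g p - g q) - (h p - h q)\<bar> = norm (h p - g p - (h q - g q))"
      by simp
    also have "\<dots> \<le> \<kappa> * dist p q"
      using dle[of p q] mult_right_mono[OF less_imp_le[OF lt] zero_le_dist[of p q]]
      by (rule order_trans)
    finally show ?thesis .
  qed
  have up: "lip_norm g \<le> lip_norm h + \<kappa>"
  proof (rule lip_norm_le)
    show "0 \<le> lip_norm h + \<kappa>" using lip_norm_nonneg[OF h] \<open>0 < \<kappa>\<close> by simp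
    show "norm (g p - g q) \<le> (lip_norm h + \<kappa>) * dist p q" for p q
      using hle[of p q] close[of p q] by (simp add: algebra_simps)
  qed
  have low: "lip_norm h \<le> lip_norm g + \<kappa>"
  proof (rule lip_norm_le)
    show "0 \<le> lip_norm g + \<kappa>" using lip_norm_nonneg[OF g0] \<open>0 < \<kappa>\<close> by simp
    show "norm (h p - h q) \<le> (lip_norm g + \<kappa>) * dist p q" for p q
      using gle[of p q] close[of p q] by (simp add: algebra_simps)
  qed
  define \<gamma> where "\<gamma> = lip_norm g"
  have \<gamma>: "0 < \<gamma>" using low assms(4,6) by (simp add: \<gamma>_def)
  obtain p0 q0 where pq: "p0 \<noteq> q0" "norm (g p0 - g q0) / dist p0 q0 = \<gamma>"
    using g by (auto simp: LipSNA_def \<gamma>_def)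
  define k where "k p = L / \<gamma> * g p" for p
  have L: "0 \<le> L" using assms(3) lip_norm_nonneg[OF h] by simp
  have kd: "k p - k q = L / \<gamma> * (g p - g q)" for p q
    by (simp add: k_def algebra_simps)
  have kn: "norm (k p - k q) = L / \<gamma> * norm (g p - g q)" for p q
    unfolding kd using L \<gamma> by (simp add: abs_mult)
  have kle: "norm (k p - k q) \<le> L * dist p q" for p q
    using mult_left_mono[OF gle[of p q], of "L / \<gamma>"] L \<gamma> unfolding kn by (simp add: \<gamma>_def)
  have k0: "k \<in> Lip0 z"
    using L kle by (rule Lip0I) (use g0 in \<open>simp add: k_def Lip0_def\<close>)
  have att: "norm (k p0 - k q0) / dist p0 q0 = L"
    using pq \<gamma> unfolding kn by (simp add: field_simps)
  have "L * dist p0 q0 \<le> lip_norm k * dist p0 q0"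
    using norm_diff_le_lip_norm[OF k0, of p0 q0] att pq(1) by (simp add: field_simps)
  then have nk: "lip_norm k = L"
    using lip_norm_le[OF L kle] pq(1) by simp
  show thesis
  proof (rule that[of k])
    show "k \<in> LipSNA z" using k0 att nk pq(1) by (auto simp: LipSNA_def)
    show "lip_norm k = L" by (rule nk)
    fix p q
    \<comment> \<open>Since \<open>g / \<gamma>\<close> is 1-Lipschitz, scaling changes slopes by at
      most the gap between the two norms.\<close>
    have "(k p - k q) - (g p - g q) = (L - \<gamma>) * ((g p - g q) / \<gamma>)"
      unfolding kd using \<gamma> by (simp add: field_simps)
    then have "\<bar>(k p - k q) - (g p - g q)\<bar> = \<bar>L - \<gamma>\<bar> * \<bar>(g p - g q) / \<gamma>\<bar>"
      by (simp only: abs_mult)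
    also have "\<dots> \<le> (\<delta> + \<kappa>) * dist p q"
    proof (rule mult_mono)
      show "\<bar>L - \<gamma>\<bar> \<le> \<delta> + \<kappa>"
        using up low assms(3,4) by (simp add: \<gamma>_def)
      show "\<bar>(g p - g q) / \<gamma>\<bar> \<le> dist p q"
        using gle[of p q] \<gamma> by (simp add: \<gamma>_def divide_le_eq mult.commute)
      show "0 \<le> \<delta> + \<kappa>" using assms(3,4,5) by linarith
    qed simp
    finally show "\<bar>(k p - k q) - (h p - h q)\<bar> \<le> (\<delta> + 2 * \<kappa>) * dist p q"
      using close[of p q] by (simp add: algebra_simps)
  qed
qed

section \<open>Lipschitz compactness of the approximant\<close>

text \<open>Each difference quotient is \<open>s *\<^sub>R w + T k\<close> with \<open>s\<close> a
  slope of \<open>h\<close>, hence in a bounded interval, and \<open>k\<close> a difference quotient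
  of \<open>G\<close>. All of them lie in a continuous image of a compact product.\<close>

lemma Lip0K_affine_combination:
  fixes G :: "'m::metric_space \<Rightarrow> 'y::real_normed_vector" and h :: "'m \<Rightarrow> real"
  assumes "G \<in> Lip0K z" and "h \<in> Lip0 z"
  shows "(\<lambda>p. h p *\<^sub>R w + blinfun_apply T (G p)) \<in> Lip0K z"
proof -
  let ?H = "\<lambda>p. h p *\<^sub>R w + T (G p)"
  let ?Q = "\<lambda>G. {(G p - G q) /\<^sub>R dist p q | p q. p \<noteq> q}"
  define L where "L = lip_norm h"
  have G: "G \<in> Lip0 z" and K: "compact (closure (?Q G))"
    using assms(1) by (auto simp: Lip0K_def)
  note Gle = norm_diff_le_lip_norm[OF G]
  have hle: "\<bar>h p - h q\<bar> \<le> L * dist p q" for p q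
    using norm_diff_le_lip_norm[OF assms(2), of p q] by (simp add: L_def)
  have diff: "?H p - ?H q = (h p - h q) *\<^sub>R w + T (G p - G q)" for p q
    by (simp add: blinfun.diff_right algebra_simps)
  have "?H \<in> Lip0 z"
  proof (rule Lip0I)
    show "0 \<le> L * norm w + norm T * lip_norm G"
      using lip_norm_nonneg[OF G] lip_norm_nonneg[OF assms(2)] by (simp add: L_def)
    fix p q
    have "norm ((h p - h q) *\<^sub>R w) \<le> L * dist p q * norm w"
      using hle[of p q] by (simp add: mult_right_mono)
    moreover have "norm (T (G p - G q)) \<le> norm T * (lip_norm G * dist p q)"
      using norm_blinfun[of T "G p - G q"] mult_left_mono[OF Gle[of p q] norm_ge_zero[of T]] by linarith
    ultimately show "norm (?H p - ?H q) \<le> (L * norm w + norm T * lip_norm G) * dist p q"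
      unfolding diff using norm_triangle_ineq[of "(h p - h q) *\<^sub>R w" "T (G p - G q)"]
      by (simp add: algebra_simps)
    show "?H z = 0" using G assms(2) by (simp add: Lip0_def)
  qed
  moreover have "compact (closure (?Q ?H))"
  proof -
    let ?C = "(\<lambda>(s, k). s *\<^sub>R w + T k) ` ({-L..L} \<times> closure (?Q G))"
    have C: "compact ?C"
      using K by (intro compact_continuous_image compact_Times)
        (auto simp: case_prod_unfold intro!: continuous_intros)
    have "?Q ?H \<subseteq> ?C"
    proof clarify
      fix p q :: 'm assume "p \<noteq> q"
      then have "(h p - h q) / dist p q \<in> {-L..L}"
        using hle[of p q] by (auto simp: field_simps abs_le_iff)
      moreover have "(G p - G q) /\<^sub>R dist p q \<in> closure (?Q G)"
        using \<open>p \<noteq> q\<close> by (intro subsetD[OF closure_subset]) auto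
      moreover have "(?H p - ?H q) /\<^sub>R dist p q
          = ((h p - h q) / dist p q) *\<^sub>R w + T ((G p - G q) /\<^sub>R dist p q)"
        unfolding diff by (simp add: blinfun.scaleR_right scaleR_add_right divide_inverse_commute)
      ultimately show "(?H p - ?H q) /\<^sub>R dist p q \<in> ?C"
        by (intro image_eqI[where x = "((h p - h q) / dist p q, (G p - G q) /\<^sub>R dist p q)"]) auto
    qed
    then have "closure (?Q ?H) \<subseteq> ?C"
      using C by (intro closure_minimal compact_imp_closed)
    then show ?thesis
      using compact_Int_closed[OF C closed_closure[of "?Q ?H"]] by (simp only: Int_absorb1)
  qed
  ultimately show ?thesis by (simp add: Lip0K_def)
qed

theorem proposition3p14:
  fixes z :: "'m::complete_space" and \<rho> :: real
  assumes "lip_dense_in (LipSNA z) (Lip0 z :: ('m \<Rightarrow> real) set)"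
    and "0 \<le> \<rho>" and "\<rho> < 1" and "has_ACK_structure TYPE('y::banach) \<rho>"
  shows "lip_dense_in (LipSNA_K z) (Lip0K z :: ('m \<Rightarrow> 'y) set)"
proof -
  have "\<exists>H \<in> LipSNA_K z. lip_norm (\<lambda>p. G p - H p) < t"
    if GK: "G \<in> Lip0K z" and t: "0 < t" for G :: "'m \<Rightarrow> 'y" and t
  proof (cases "lip_norm G = 0")
    case True
    \<comment> \<open>A map of norm 0 attains it at any two distinct points. Such points exist
      because density, applied to the zero function, shows that the scalar \<open>LipSNA z\<close>
      is nonempty.\<close>
    have "(\<lambda>_. 0 :: real) \<in> Lip0 z" by (rule Lip0I[of 0]) auto
    then obtain g :: "'m \<Rightarrow> real" where "g \<in> LipSNA z"
      using assms(1) t unfolding lip_dense_in_def by blast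
    then obtain p q :: 'm where "p \<noteq> q" by (auto simp: LipSNA_def)
    moreover have "G \<in> Lip0 z" using GK by (simp add: Lip0K_def)
    ultimately have "G \<in> LipSNA_K z"
      using GK True norm_diff_le_lip_norm[of G z p q] by (auto simp: LipSNA_K_def LipSNA_def)
    moreover have "lip_norm (\<lambda>p. G p - G p) < t"
      using lip_norm_le[of 0 "\<lambda>p. G p - G p"] t by simp
    ultimately show ?thesis by (intro bexI[where x = G])
  next
    case False
    define L where "L = lip_norm G"
    have G0: "G \<in> Lip0 z" using GK by (simp add: Lip0K_def)
    have L: "0 < L" using False lip_norm_nonneg[OF G0] by (simp add: L_def)
    \<comment> \<open>The final distance will be at most \<open>3 * (\<eta> * L)\<close>, which is
      below \<open>t\<close>. The slack outside \<open>V1\<close> is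
      \<open>\<eta> * (1 - \<rho>) * L\<close>, and \<delta> is a ninth of it because the errors add
      up to \<open>9 * \<delta>\<close>. The choice of \<epsilon> gives
      \<open>\<epsilon> * L = \<delta>\<close>, and \<open>\<epsilon> \<le> \<eta>\<close> is needed
      inside \<open>V1\<close>.\<close>
    define \<eta> where "\<eta> = min (1/2) (t / (4 * L))"
    define \<delta> where "\<delta> = \<eta> * (1 - \<rho>) * L / 9"
    define \<epsilon> where "\<epsilon> = \<delta> / L"
    have \<eta>: "0 < \<eta>" "\<eta> \<le> 1/2" using L t by (auto simp: \<eta>_def)
    have "\<eta> \<le> t / (4 * L)" by (simp add: \<eta>_def)
    then have \<eta>L: "4 * (\<eta> * L) \<le> t" using L by (simp add: field_simps)
    have \<delta>: "0 < \<delta>" using L \<eta> assms(3) by (simp add: \<delta>_def)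
    have \<delta>9: "9 * \<delta> = \<eta> * L - \<eta> * \<rho> * L" by (simp add: \<delta>_def field_simps)
    have "0 \<le> \<eta> * \<rho> * L" using L \<eta> assms(2) by simp
    then have \<delta>\<eta>: "9 * \<delta> \<le> \<eta> * L" using \<delta>9 by simp
    have "\<eta> * L \<le> 1/2 * L" using \<eta> L by (intro mult_right_mono) auto
    then have \<delta>L: "3 * \<delta> < L" using \<delta>\<eta> \<delta> L by linarith
    have \<epsilon>: "0 < \<epsilon>" "\<epsilon> * L = \<delta>" using \<delta> L by (auto simp: \<epsilon>_def)
    have \<epsilon>\<eta>: "\<epsilon> \<le> \<eta>"
      using \<delta>\<eta> \<delta> \<epsilon> L by (smt (verit) mult_le_cancel_right)
    note Gle = norm_diff_le_lip_norm[OF G0, folded L_def]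

    \<comment> \<open>Choice of the ACK data\<close>
    obtain \<Gamma> :: "('y \<Rightarrow>\<^sub>L real) set" where norming: "one_norming \<Gamma>"
      and ack: "\<forall>\<epsilon>>0. \<forall>U. openin (subtopology weak_star \<Gamma>) U \<and> U \<noteq> {} \<longrightarrow>
        (\<exists>V y1 e. \<exists>F :: 'y \<Rightarrow>\<^sub>L 'y.
           V \<noteq> {} \<and> V \<subseteq> U \<and> y1 \<in> V \<and> e \<in> sphere 0 1 \<and>
           norm (blinfun_apply F e) = 1 \<and> norm F = 1 \<and>
           blinfun_apply y1 (blinfun_apply F e) = 1 \<and> adjoint_blinfun F y1 = y1 \<and>
           (\<forall>v \<in> \<Gamma> - ACK_V1 \<Gamma> \<epsilon> F. \<bar>blinfun_apply v (blinfun_apply F e)\<bar> \<le> \<rho>) \<and>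
           (\<forall>f \<in> \<Gamma>. infdist (adjoint_blinfun F f) (absolutely_convex hull ({0} \<union> V)) < \<epsilon>) \<and>
           (\<forall>v \<in> V. \<bar>blinfun_apply v e - 1\<bar> \<le> \<epsilon>))"
      using assms(4) unfolding has_ACK_structure_def by (elim exE conjE) (rule that)
    have \<Gamma>1: "\<And>f. f \<in> \<Gamma> \<Longrightarrow> norm f \<le> 1" and \<Gamma>sub: "\<Gamma> \<subseteq> cball 0 1"
      using norming by (auto simp: one_norming_def)

    \<comment> \<open>The pair and \<open>f0\<close> almost realise the norm of \<open>G\<close>.
      Every functional in the neighbourhood \<open>U\<close> of \<open>f0\<close> then does so too,
      in particular the later \<open>y1\<close>.\<close>
    obtain p0 q0 where pq0: "p0 \<noteq> q0" "(L - \<delta>) * dist p0 q0 < norm (G p0 - G q0)"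
      using less_lip_normD[of "L - \<delta>" G] \<delta> \<delta>L by (auto simp: L_def)
    moreover have "0 \<le> (L - \<delta>) * dist p0 q0" using \<delta> \<delta>L by simp
    ultimately obtain f0 where f0: "f0 \<in> \<Gamma>" "(L - \<delta>) * dist p0 q0 < \<bar>f0 (G p0 - G q0)\<bar>"
      using norm_le_of_one_norming[OF norming] by (meson not_le)
    let ?Q = "{(G p - G q) /\<^sub>R dist p q | p q. p \<noteq> q}"
    have K: "compact (closure ?Q)" using GK by (simp add: Lip0K_def)
    obtain U where U: "openin (subtopology weak_star \<Gamma>) U" "f0 \<in> U"
      and U_close: "\<And>f k. f \<in> U \<Longrightarrow> k \<in> closure ?Q \<Longrightarrow> \<bar>f k - f0 k\<bar> \<le> \<delta>"
      by (rule weak_star_nbhd_uniform_on_compact[OF K \<Gamma>sub f0(1) \<delta>]) (rule that)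
    have Uf0: "\<bar>f (G p - G q) - f0 (G p - G q)\<bar> \<le> \<delta> * dist p q" if "f \<in> U" for f p q
    proof (cases "p = q")
      case False
      then have "(G p - G q) /\<^sub>R dist p q \<in> closure ?Q"
        by (intro subsetD[OF closure_subset]) auto
      from U_close[OF that this] False show ?thesis
        by (simp add: blinfun.scaleR_right flip: right_diff_distrib)
          (simp add: abs_mult field_simps)
    qed simp

    have "U \<noteq> {}" using U(2) by blast
    obtain V and y1 :: "'y \<Rightarrow>\<^sub>L real" and e and F :: "'y \<Rightarrow>\<^sub>L 'y"
      where V: "V \<subseteq> U" "y1 \<in> V" and e: "norm e = 1" and Fe: "norm (F e) = 1"
      and F: "norm F = 1" and y1Fe: "y1 (F e) = 1" and y1F: "adjoint_blinfun F y1 = y1"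
      and V1: "\<And>v. v \<in> \<Gamma> \<Longrightarrow> v \<notin> ACK_V1 \<Gamma> \<epsilon> F \<Longrightarrow> \<bar>v (F e)\<bar> \<le> \<rho>"
      and inf: "\<And>f. f \<in> \<Gamma> \<Longrightarrow>
        infdist (adjoint_blinfun F f) (absolutely_convex hull ({0} \<union> V)) < \<epsilon>"
      and Ve: "\<And>v :: 'y \<Rightarrow>\<^sub>L real. v \<in> V \<Longrightarrow> \<bar>v e - 1\<bar> \<le> \<epsilon>"
      using ack[rule_format, OF \<epsilon>(1) conjI[OF U(1) \<open>U \<noteq> {}\<close>]]
      by (elim exE conjE) (rule that, assumption, assumption, simp only: mem_sphere_0, assumption+, blast+)
    have y1U: "y1 \<in> U" and y1\<Gamma>: "y1 \<in> \<Gamma>"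
      using V openin_imp_subset[OF U(1)] by auto
    \<comment> \<open>Both \<open>v\<close> and \<open>y1\<close> are compared with
      \<open>f0\<close>, hence the factor 2.\<close>
    have VG: "\<bar>v (G p - G q) - y1 (G p - G q)\<bar> \<le> 2 * \<delta> * dist p q" if "v \<in> V" for v p q
      using Uf0[of v p q] Uf0[OF y1U, of p q] that V(1) by auto
    have \<Gamma>x: "\<bar>f x\<bar> \<le> norm x" if "f \<in> \<Gamma>" for f x
      using abs_blinfun_le_norm[OF \<Gamma>1[OF that]] .
    have Fx: "norm (F x) \<le> norm x" for x
      using norm_blinfun[of F x] F by simp

    \<comment> \<open>The scalar function \<open>y1 \<circ> G\<close> and its attaining
      approximation\<close>
    define h0 where "h0 p = y1 (G p)" for p
    have h0d: "h0 p - h0 q = y1 (G p - G q)" for p q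
      by (simp add: h0_def blinfun.diff_right)
    have h0le: "norm (h0 p - h0 q) \<le> L * dist p q" for p q
      unfolding h0d using \<Gamma>x[OF y1\<Gamma>, of "G p - G q"] Gle[of p q] by simp
    have h0: "h0 \<in> Lip0 z"
      using L h0le by (intro Lip0I[of L]) (use G0 in \<open>auto simp: h0_def Lip0_def\<close>)
    have "(L - 2 * \<delta>) * dist p0 q0 \<le> norm (h0 p0 - h0 q0)"
      unfolding h0d using f0(2) Uf0[OF y1U, of p0 q0] by (simp add: algebra_simps)
    also have "\<dots> \<le> lip_norm h0 * dist p0 q0"
      by (rule norm_diff_le_lip_norm[OF h0])
    finally have "L - 2 * \<delta> \<le> lip_norm h0" using pq0(1) by simp
    moreover have "lip_norm h0 \<le> L" using L h0le by (intro lip_norm_le) auto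
    \<comment> \<open>The norm of \<open>h0\<close> falls short of \<open>L\<close> by at most
      \<open>2 * \<delta>\<close>; taking \<open>\<kappa> = \<delta>\<close> adds another
      \<open>2 * \<delta>\<close>.\<close>
    ultimately obtain h where h: "h \<in> LipSNA z" "lip_norm h = L"
      and hh0: "\<And>p q. \<bar>(h p - h q) - (h0 p - h0 q)\<bar> \<le> (2 * \<delta> + 2 * \<delta>) * dist p q"
      using LipSNA_approx_with_norm[OF assms(1) h0, of L "2 * \<delta>" \<delta>] \<delta> \<delta>L by auto
    have h_Lip0: "h \<in> Lip0 z" using h(1) by (simp add: LipSNA_def)
    have hle: "\<bar>h p - h q\<bar> \<le> L * dist p q" for p q
      using norm_diff_le_lip_norm[OF h_Lip0, of p q] h(2) by simp

    \<comment> \<open>The approximant and its norm bound\<close>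
    define T where "T = (1 - \<eta>) *\<^sub>R (id_blinfun - F)"
    have T: "T x = (1 - \<eta>) *\<^sub>R (x - F x)" for x
      by (simp add: T_def blinfun.scaleR_left blinfun.diff_left)
    define H where "H p = h p *\<^sub>R F e + T (G p)" for p
    have HK: "H \<in> Lip0K z"
      unfolding H_def using GK h_Lip0 by (rule Lip0K_affine_combination)
    then have H0: "H \<in> Lip0 z" by (simp add: Lip0K_def)
    have vH: "v (H p - H q) = (h p - h q) * v (F e) + (1 - \<eta>) * (v (G p - G q) - v (F (G p - G q)))"
      for v :: "'y \<Rightarrow>\<^sub>L real" and p q
      unfolding H_def T blinfun.diff_right blinfun.add_right blinfun.scaleR_right
      by (simp add: algebra_simps)

    \<comment> \<open>The nine splits as 2 for the oscillation over \<open>V\<close>, 3 from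
      \<open>3 * \<epsilon> * L\<close>, and 4 for replacing \<open>y1 \<circ> G\<close> by
      \<open>h\<close>.\<close>
    have key: "\<bar>v (F (G p - G q)) - v (F e) * (h p - h q)\<bar> \<le> 9 * \<delta> * dist p q" if v: "v \<in> \<Gamma>" for v p q
    proof -
      have "\<bar>v (F (G p - G q)) - v (F e) * y1 (G p - G q)\<bar>
          \<le> 2 * \<delta> * dist p q + 3 * \<epsilon> * (L * dist p q)"
        using VG Ve \<delta> by (intro adjoint_estimate[OF inf[OF v] e \<Gamma>1[OF y1\<Gamma>] Gle]) auto
      moreover have "3 * \<epsilon> * (L * dist p q) = 3 * \<delta> * dist p q"
        using \<epsilon>(2) by (metis mult.assoc)
      moreover have "\<bar>v (F e) * ((h p - h q) - y1 (G p - G q))\<bar> \<le> 1 * (4 * \<delta> * dist p q)"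
        unfolding abs_mult using \<Gamma>x[OF v, of "F e"] Fe hh0[of p q]
        by (intro mult_mono) (auto simp: h0d)
      ultimately show ?thesis by (simp add: right_diff_distrib)
    qed

    have Hle: "norm (H p - H q) \<le> L * dist p q" for p q
    proof (rule norm_le_of_one_norming[OF norming])
      show "0 \<le> L * dist p q" using L by simp
      fix v assume v: "v \<in> \<Gamma>"
      let ?x = "G p - G q" and ?s = "h p - h q" and ?D = "L * dist p q"
      show "\<bar>v (H p - H q)\<bar> \<le> ?D"
      proof (cases "v \<in> ACK_V1 \<Gamma> \<epsilon> F")
        case True
        let ?a = "norm (adjoint_blinfun F v)" and ?b = "norm (v - adjoint_blinfun F v)"
        have "\<bar>v (F e)\<bar> \<le> ?a"
          using norm_blinfun[of "adjoint_blinfun F v" e] e by (simp add: adjoint_blinfun_def)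
        then have "\<bar>?s * v (F e)\<bar> \<le> ?D * ?a"
          unfolding abs_mult using hle[of p q] L by (intro mult_mono) auto
        moreover have "\<bar>v ?x - v (F ?x)\<bar> \<le> ?b * norm ?x"
          using norm_blinfun[of "v - adjoint_blinfun F v" ?x]
          by (simp add: adjoint_blinfun_def blinfun.diff_left)
        then have "\<bar>v ?x - v (F ?x)\<bar> \<le> ?b * ?D"
          using mult_left_mono[OF Gle[of p q] norm_ge_zero[of "v - adjoint_blinfun F v"]] by linarith
        \<comment> \<open>Here \<open>1 - \<eta> \<le> 1 - \<epsilon>\<close> brings in the weight
          from the definition of \<open>V1\<close>.\<close>
        then have "\<bar>(1 - \<eta>) * (v ?x - v (F ?x))\<bar> \<le> (1 - \<epsilon>) * (?b * ?D)"
          unfolding abs_mult using \<eta> \<epsilon>\<eta> by (intro mult_mono) auto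
        ultimately have "\<bar>v (H p - H q)\<bar> \<le> ?D * (?a + (1 - \<epsilon>) * ?b)"
          unfolding vH by (simp add: algebra_simps)
        also have "\<dots> \<le> ?D * 1"
          using True L by (intro mult_left_mono) (auto simp: ACK_V1_def)
        finally show ?thesis by simp
      next
        case False
        \<comment> \<open>Trading \<open>v (F ?x)\<close> for \<open>v (F e) * ?s\<close> leaves
          weight \<eta> on a term of size at most \<open>\<rho> * ?D\<close>. The gain
          \<open>\<eta> * (1 - \<rho>) * ?D\<close> exactly pays for the error
          \<open>9 * \<delta> * dist p q\<close>.\<close>
        have "v (H p - H q) = (1 - \<eta>) * v ?x + \<eta> * (v (F e) * ?s)
            - (1 - \<eta>) * (v (F ?x) - v (F e) * ?s)"
          unfolding vH by (simp add: algebra_simps)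
        moreover have "\<bar>(1 - \<eta>) * v ?x\<bar> \<le> (1 - \<eta>) * ?D"
          unfolding abs_mult using \<eta> \<Gamma>x[OF v, of ?x] Gle[of p q] by (intro mult_mono) auto
        moreover have "\<bar>v (F e) * ?s\<bar> \<le> \<rho> * ?D"
          unfolding abs_mult using V1[OF v False] hle[of p q] assms(2) by (intro mult_mono) auto
        then have "\<bar>\<eta> * (v (F e) * ?s)\<bar> \<le> \<eta> * (\<rho> * ?D)"
          unfolding abs_mult[of \<eta>] using \<eta> by (intro mult_mono) auto
        moreover have "\<bar>(1 - \<eta>) * (v (F ?x) - v (F e) * ?s)\<bar> \<le> 1 * (9 * \<delta> * dist p q)"
          unfolding abs_mult[of "1 - \<eta>"] using \<eta> key[OF v, of p q] by (intro mult_mono) auto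
        moreover have "9 * \<delta> * dist p q = \<eta> * ?D - \<eta> * (\<rho> * ?D)"
          unfolding \<delta>9 by (simp add: algebra_simps)
        ultimately show ?thesis by (simp add: algebra_simps)
      qed
    qed
    then have lipH: "lip_norm H \<le> L" using L by (intro lip_norm_le) auto

    \<comment> \<open>Norm attainment and distance to \<open>G\<close>\<close>
    obtain p1 q1 where pq1: "p1 \<noteq> q1" "norm (h p1 - h q1) / dist p1 q1 = L"
      using h by (auto simp: LipSNA_def)
    have "y1 (F x) = y1 x" for x
      using arg_cong[OF y1F, of "\<lambda>f. blinfun_apply f x"] by (simp add: adjoint_blinfun_def)
    \<comment> \<open>Since \<open>y1 \<circ> F = y1\<close>, the functional \<open>y1\<close>
      annihilates the range of \<open>T\<close>.\<close>
    then have "y1 (H p1 - H q1) = h p1 - h q1"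
      unfolding vH using y1Fe by simp
    then have "L * dist p1 q1 \<le> norm (H p1 - H q1)"
      using \<Gamma>x[OF y1\<Gamma>, of "H p1 - H q1"] pq1 by (auto simp: field_simps)
    moreover have "norm (H p1 - H q1) \<le> lip_norm H * dist p1 q1"
      by (rule norm_diff_le_lip_norm[OF H0])
    moreover have "lip_norm H * dist p1 q1 \<le> L * dist p1 q1"
      using lipH by (intro mult_right_mono) auto
    ultimately have "norm (H p1 - H q1) = lip_norm H * dist p1 q1" by linarith
    then have "norm (H p1 - H q1) / dist p1 q1 = lip_norm H" using pq1(1) by simp
    then have "H \<in> LipSNA z"
      using H0 pq1(1) unfolding LipSNA_def by blast
    then have "H \<in> LipSNA_K z" using HK by (simp add: LipSNA_K_def)
    moreover have "lip_norm (\<lambda>p. G p - H p) \<le> 3 * (\<eta> * L)"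
    proof (intro lip_norm_le norm_le_of_one_norming[OF norming])
      show "0 \<le> 3 * (\<eta> * L)" "0 \<le> 3 * (\<eta> * L) * dist p q" for p q :: 'm
        using \<eta> L by auto
      fix p q v assume v: "v \<in> \<Gamma>"
      let ?x = "G p - G q" and ?s = "h p - h q" and ?D = "L * dist p q"
      have "v (G p - H p - (G q - H q)) = v ?x - v (H p - H q)"
        by (simp add: blinfun.diff_right)
      \<comment> \<open>The first term is covered by \<open>key\<close> and is at most
        \<open>\<eta> * ?D\<close>; the second, caused by the damping factor, is at most
        \<open>2 * \<eta> * ?D\<close>.\<close>
      also have "\<dots> = (v (F ?x) - v (F e) * ?s) + \<eta> * (v ?x - v (F ?x))"
        unfolding vH by (simp add: algebra_simps)
      finally have eq: "v (G p - H p - (G q - H q)) = \<dots>" .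
      have "\<bar>v ?x - v (F ?x)\<bar> \<le> 2 * ?D"
        using \<Gamma>x[OF v, of ?x] \<Gamma>x[OF v, of "F ?x"] Fx[of ?x] Gle[of p q] by linarith
      then have "\<bar>\<eta> * (v ?x - v (F ?x))\<bar> \<le> \<eta> * (2 * ?D)"
        unfolding abs_mult using \<eta> by (intro mult_mono) auto
      moreover have "9 * \<delta> * dist p q \<le> \<eta> * L * dist p q"
        using \<delta>\<eta> by (intro mult_right_mono) auto
      ultimately show "\<bar>v (G p - H p - (G q - H q))\<bar> \<le> 3 * (\<eta> * L) * dist p q"
        unfolding eq using key[OF v, of p q] by (simp add: algebra_simps)
    qed
    moreover have "3 * (\<eta> * L) < t"
      using \<eta>L mult_pos_pos[OF \<eta>(1) L] by linarith
    ultimately show ?thesis by (intro bexI[where x = H]) linarith+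
  qed
  then show ?thesis
    unfolding lip_dense_in_def by (auto simp: LipSNA_K_def)
qed

end
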